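(* Let $H$ be a real Hilbert space, $I\ge 1$ an integer and $\mathcal{I}=\{1,\dots,I\}$. For each $i\in\mathcal{I}$ let $T^{(i)}\colon H\to H$ be firmly nonexpansive, with $X:=\bigcap_{i\in\mathcal{I}}\mathrm{Fix}(T^{(i)})\neq\emptyset$, and let $f^{(i)}\colon H\to\mathbb{R}$ be continuous and convex; put $f:=\sum_{i\in\mathcal{I}}f^{(i)}$. Let $(\alpha_n)_{n\in\mathbb{N}}\subset(0,1]$ and $(\gamma_n)_{n\in\mathbb{N}}\subset(0,\infty)$ satisfy $$0<\liminf_{n\to\infty}\alpha_n\le\limsup_{n\to\infty}\alpha_n<1,\quad \lim_{n\to\infty}\gamma_n=0,\quad \sum_{n=0}^\infty\gamma_n=\infty.$$ Let $x_0\in H$ be arbitrary, and for $n\in\mathbb{N}$ define $x_n^{(0)}:=x_n$ and, for $i=1,2,\dots,I$, $$y_n^{(i)}:=\mathrm{Prox}_{\gamma_n f^{(i)}}\left(x_n^{(i-1)}\right),\qquad x_n^{(i)}:=\alpha_n x_n^{(i-1)}+(1-\alpha_n)T^{(i)}\left(y_n^{(i)}\right),$$ and $x_{n+1}:=x_n^{(I)}$. Assume that the sequence $(y_n^{(i)})_{n\in\mathbb{N}}$ is bounded for every $i\in\mathcal{I}$. Then, for every $i\in\mathcal{I}$, there exists a weak sequential cluster point of $(x_n^{(i)})_{n\in\mathbb{N}}$ which belongs to the solution set $\{x\in X\colon f(x)\le f(z)\text{ for all }z\in X\}$ of the problem of minimizing $f$ over $X$.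
   Context: $\mathbb{N}$ denotes the nonnegative integers. $\mathrm{Fix}(T)=\{x\in H\colon T(x)=x\}$. A mapping $T\colon H\to H$ is firmly nonexpansive if $\|T(x)-T(y)\|^2+\|(\mathrm{Id}-T)(x)-(\mathrm{Id}-T)(y)\|^2\le\|x-y\|^2$ for all $x,y\in H$. For a proper, lower semicontinuous, convex function $g$ on $H$, $\mathrm{Prox}_g(x)$ is the unique minimizer over $y\in H$ of $g(y)+\frac12\|x-y\|^2$. A weak sequential cluster point of a sequence in $H$ is the weak limit of some subsequence. *)

theory Defs
  imports "HOL-Analysis.Analysis"
begin

definition Fix :: "('a \<Rightarrow> 'a) \<Rightarrow> 'a set" where
  "Fix T = {x. T x = x}"

definition firmly_nonexpansive :: "('a::real_inner \<Rightarrow> 'a) \<Rightarrow> bool" where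
  "firmly_nonexpansive T \<longleftrightarrow>
     (\<forall>x y. (norm (T x - T y))\<^sup>2 + (norm ((x - T x) - (y - T y)))\<^sup>2 \<le> (norm (x - y))\<^sup>2)"

text \<open>The description operator yields the minimizer whenever it exists and is unique; on a
  Hilbert space this is the case for every continuous convex \<open>g\<close>.\<close>

definition Prox :: "('a::real_inner \<Rightarrow> real) \<Rightarrow> 'a \<Rightarrow> 'a" where
  "Prox g x = (THE y. is_arg_min (\<lambda>y. g y + 1/2 * (norm (x - y))\<^sup>2) (\<lambda>_. True) y)"

text \<open>Weak convergence in a Hilbert space, where the continuous linear functionals are
  exactly the maps \<open>\<lambda>v. v \<bullet> u\<close>.\<close>

definition weakly_tendsto :: "(nat \<Rightarrow> 'a::real_inner) \<Rightarrow> 'a \<Rightarrow> bool" where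
  "weakly_tendsto s p \<longleftrightarrow> (\<forall>u. (\<lambda>n. s n \<bullet> u) \<longlonglongrightarrow> p \<bullet> u)"

definition weak_seq_cluster_point :: "(nat \<Rightarrow> 'a::real_inner) \<Rightarrow> 'a \<Rightarrow> bool" where
  "weak_seq_cluster_point s p \<longleftrightarrow> (\<exists>r::nat \<Rightarrow> nat. strict_mono r \<and> weakly_tendsto (s \<circ> r) p)"

end

theory Submission
  imports Defs
begin

text \<open>Let \<open>D n\<close> be the sum over \<open>i\<close> of the squared residuals
  \<open>\<parallel>xi n (i - 1) - yi n i\<parallel>\<^sup>2 + \<parallel>yi n i - T i (yi n i)\<parallel>\<^sup>2\<close> and \<open>S n\<close> the sum of the
  \<open>f i (yi n i)\<close>. For \<open>z \<in> X\<close> one has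
  \<open>\<parallel>x (n + 1) - z\<parallel>\<^sup>2 \<le> \<parallel>x n - z\<parallel>\<^sup>2 - (1 - \<alpha> n) (D n + 2 \<gamma> n (S n - F z))\<close>,
  and \<open>S\<close> is bounded below. If \<open>D n \<ge> e\<close> or \<open>S n \<ge> F z + e\<close> for each large \<open>n\<close>, the right-hand
  side drops by at least a fixed multiple of \<open>\<gamma> n\<close> in each step, contradicting the divergence of
  the sum of the \<open>\<gamma> n\<close>. Hence there is a subsequence along which \<open>D\<close> tends to \<open>0\<close> and the upper
  limit of \<open>S\<close> is at most the infimum of \<open>F\<close> over \<open>X\<close>. All \<open>xi n i\<close> and \<open>yi n i\<close> then
  share a weak limit along a further subsequence; it lies in \<open>X\<close> by demiclosedness and
  minimizes \<open>F\<close> because every \<open>f i\<close> is weakly lower semicontinuous. This avoids Lipschitz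
  bounds for \<open>f i\<close> on bounded sets, which continuity does not give in infinite dimension.\<close>

subsection \<open>Proximal points and projections\<close>

lemma power2_norm_convex_comb:
  fixes a b :: "'a::real_inner"
  shows "(norm ((1 - t) *\<^sub>R a + t *\<^sub>R b))\<^sup>2
    = (1 - t) * (norm a)\<^sup>2 + t * (norm b)\<^sup>2 - t * (1 - t) * (norm (a - b))\<^sup>2"
  unfolding power2_norm_eq_inner
  by (simp add: inner_simps inner_commute) algebra

text \<open>Strong convexity of the proximal objective: the quadratic term satisfies the convexity
  inequality as an identity with a gain, and \<open>g\<close> only adds its own convexity.\<close>

lemma convex_plus_power2_norm_le:
  fixes g :: "'a::real_inner \<Rightarrow> real" and x :: 'a
  assumes "convex_on C g" "y \<in> C" "z \<in> C" "0 \<le> t" "t \<le> 1"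
  defines "h \<equiv> \<lambda>y. g y + 1/2 * (norm (x - y))\<^sup>2"
  shows "h ((1 - t) *\<^sub>R y + t *\<^sub>R z) \<le> (1 - t) * h y + t * h z - t * (1 - t) / 2 * (norm (y - z))\<^sup>2"
proof -
  have "x - ((1 - t) *\<^sub>R y + t *\<^sub>R z) = (1 - t) *\<^sub>R (x - y) + t *\<^sub>R (x - z)"
    by (simp add: algebra_simps)
  then have "(norm (x - ((1 - t) *\<^sub>R y + t *\<^sub>R z)))\<^sup>2
      = (1 - t) * (norm (x - y))\<^sup>2 + t * (norm (x - z))\<^sup>2 - t * (1 - t) * (norm (y - z))\<^sup>2"
    using power2_norm_convex_comb[of t "x - y" "x - z"] by (simp add: norm_minus_commute)
  then show ?thesis
    using convex_onD[OF assms(1) assms(4,5,2,3)] by (simp add: h_def field_simps)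
qed

text \<open>Strong convexity makes every minimizing sequence Cauchy, so completeness replaces
  compactness. The conclusion includes quadratic growth away from the minimizer. A general
  \<open>C\<close> covers both projections (\<open>g\<close> zero) and proximal points
  (\<open>C = UNIV\<close>).\<close>

lemma ex_min_convex_plus_power2_norm:
  fixes g :: "'a::{real_inner, complete_space} \<Rightarrow> real"
  assumes "closed C" "C \<noteq> {}" and cont: "continuous_on C g" and conv: "convex_on C g"
    and bdd: "\<And>y. y \<in> C \<Longrightarrow> m \<le> g y + 1/2 * (norm (x - y))\<^sup>2"
  obtains y where "y \<in> C"
    "\<And>z. z \<in> C \<Longrightarrow> g y + 1/2 * (norm (x - y))\<^sup>2 + 1/2 * (norm (y - z))\<^sup>2 \<le> g z + 1/2 * (norm (x - z))\<^sup>2"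
proof -
  define h where "h = (\<lambda>y. g y + 1/2 * (norm (x - y))\<^sup>2)"
  define \<mu> where "\<mu> = Inf (h ` C)"
  have h_conv: "h ((1 - t) *\<^sub>R y + t *\<^sub>R z) \<le> (1 - t) * h y + t * h z - t * (1 - t) / 2 * (norm (y - z))\<^sup>2"
    if "y \<in> C" "z \<in> C" "0 \<le> t" "t \<le> 1" for y z t
    using convex_plus_power2_norm_le[OF conv that] by (simp add: h_def)
  have in_C: "(1 - t) *\<^sub>R y + t *\<^sub>R z \<in> C" if "y \<in> C" "z \<in> C" "0 \<le> t" "t \<le> 1" for y z t
    using convex_on_imp_convex[OF conv] that by (auto simp: convex_def)
  have bdd': "bdd_below (h ` C)"
    using bdd by (auto simp: bdd_below_def h_def)
  have \<mu>_le: "\<mu> \<le> h y" if "y \<in> C" for y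
    unfolding \<mu>_def using that bdd' by (auto intro: cInf_lower)
  have "\<exists>y\<in>C. h y < \<mu> + 1 / Suc k" for k
    using cInf_lessD[of "h ` C" "\<mu> + 1 / Suc k"] \<open>C \<noteq> {}\<close> by (auto simp: \<mu>_def)
  then obtain s where s: "\<And>k. s k \<in> C" "\<And>k. h (s k) < \<mu> + 1 / Suc k"
    by metis
  \<comment> \<open>Midpoint argument: at t = 1/2 the gain is 1/8 of the squared distance, while
    both values lie within \<open>1 / Suc N\<close> of the infimum.\<close>
  have close: "(norm (s j - s k))\<^sup>2 \<le> 8 / Suc N" if "N \<le> j" "N \<le> k" for N j k
  proof -
    have "\<mu> \<le> 1/2 * h (s j) + 1/2 * h (s k) - 1/8 * (norm (s j - s k))\<^sup>2"
      using h_conv[of "s j" "s k" "1/2"] \<mu>_le[OF in_C[of "s j" "s k" "1/2"]] s(1) by simp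
    moreover have "1 / Suc j \<le> 1 / Suc N" "1 / Suc k \<le> 1 / Suc N"
      using that by (auto simp: frac_le)
    ultimately show ?thesis
      using s(2)[of j] s(2)[of k] by linarith
  qed
  have "Cauchy s"
  proof (rule metric_CauchyI)
    fix e :: real assume "e > 0"
    then obtain N where N: "8 / e\<^sup>2 < real N"
      using reals_Archimedean2 by blast
    have "dist (s j) (s k) < e" if "N \<le> j" "N \<le> k" for j k
    proof -
      have "8 < e\<^sup>2 * (1 + real N)"
      proof -
        have "8 < e\<^sup>2 * real N"
          using N \<open>e > 0\<close> by (simp add: field_simps)
        also have "\<dots> \<le> e\<^sup>2 * (1 + real N)"
          by (intro mult_left_mono) auto
        finally show ?thesis .
      qed
      then have "8 / Suc N < e\<^sup>2"
        by (simp add: field_simps)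
      then have "(norm (s j - s k))\<^sup>2 < e\<^sup>2"
        using close[OF that] by linarith
      then show ?thesis
        using \<open>e > 0\<close> by (simp add: dist_norm power2_less_imp_less)
    qed
    then show "\<exists>M. \<forall>m\<ge>M. \<forall>n\<ge>M. dist (s m) (s n) < e"
      by blast
  qed
  then obtain y where y: "s \<longlonglongrightarrow> y"
    by (auto simp: Cauchy_convergent_iff convergent_def)
  then have "y \<in> C"
    using \<open>closed C\<close> s(1) closed_sequentially by blast
  have "continuous_on C h"
    unfolding h_def using cont by (intro continuous_intros)
  then have "(\<lambda>k. h (s k)) \<longlonglongrightarrow> h y"
    using y \<open>y \<in> C\<close> s(1) by (auto simp: continuous_on_sequentially o_def)
  moreover have "(\<lambda>k. \<mu> + 1 / Suc k) \<longlonglongrightarrow> \<mu> + 0"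
    by (intro tendsto_intros LIMSEQ_Suc lim_1_over_n)
  ultimately have "h y \<le> \<mu> + 0"
    using s(2) by (intro LIMSEQ_le[of "\<lambda>k. h (s k)"]) (auto intro: less_imp_le)
  have "h y + 1/2 * (norm (y - z))\<^sup>2 \<le> h z" if "z \<in> C" for z
  proof -
    \<comment> \<open>For t > 0 the growth bound carries a factor 1 - t; dividing by t and then
      letting t tend to 0 from the right yields the full 1/2.\<close>
    have *: "h y + (1 - t) / 2 * (norm (y - z))\<^sup>2 \<le> h z" if "0 < t" "t < 1" for t
    proof -
      have "h y \<le> (1 - t) * h y + t * h z - t * (1 - t) / 2 * (norm (y - z))\<^sup>2"
        using h_conv[of y z t] \<mu>_le[OF in_C[of y z t]] \<open>h y \<le> \<mu> + 0\<close> \<open>y \<in> C\<close> \<open>z \<in> C\<close> that by auto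
      then have "t * (h y + (1 - t) / 2 * (norm (y - z))\<^sup>2) \<le> t * h z"
        by (simp add: algebra_simps)
      then show ?thesis using that by simp
    qed
    have "((\<lambda>t. h y + (1 - t) / 2 * (norm (y - z))\<^sup>2) \<longlongrightarrow> h y + (1 - 0) / 2 * (norm (y - z))\<^sup>2) (at_right 0)"
      by (intro tendsto_intros) auto
    moreover have "eventually (\<lambda>t. h y + (1 - t) / 2 * (norm (y - z))\<^sup>2 \<le> h z) (at_right 0)"
      using * by (auto simp: eventually_at_right_field intro!: exI[of _ 1])
    ultimately show ?thesis
      by (intro tendsto_upperbound[where F = "at_right (0::real)"]) auto
  qed
  with \<open>y \<in> C\<close> show thesis
    by (intro that) (auto simp: h_def)
qed

text \<open>Near 0 the function stays below \<open>g 0 + 1\<close>. Since 0 lies between any nonzero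
  \<open>y\<close> and a point of that small ball opposite to \<open>y\<close>, convexity prevents
  \<open>g\<close> from falling faster than linearly in the norm.\<close>

lemma continuous_convex_lower_bound:
  fixes g :: "'a::real_inner \<Rightarrow> real"
  assumes "continuous_on UNIV g" "convex_on UNIV g"
  obtains K c where "0 < K" "\<And>y. c - K * norm y \<le> g y"
proof -
  from assms(1) have "isCont g 0"
    by (simp add: continuous_on_eq_continuous_at)
  then obtain r where "r > 0" and r: "\<And>y. dist y 0 < r \<Longrightarrow> dist (g y) (g 0) < 1"
    by (metis continuous_at_eps_delta zero_less_one)
  define \<rho> where "\<rho> = r / 2"
  have "\<rho> > 0"
    using \<open>r > 0\<close> by (simp add: \<rho>_def)
  have \<rho>: "g y \<le> g 0 + 1" if "norm y \<le> \<rho>" for y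
    using that \<open>r > 0\<close> r[of y] by (auto simp: \<rho>_def dist_real_def)
  have "g 0 - 1 / \<rho> * norm y \<le> g y" for y
  proof (cases "y = 0")
    case False
    define n where "n = norm y"
    have "n > 0" using False by (simp add: n_def)
    define t where "t = n / (n + \<rho>)"
    have t: "0 \<le> t" "t \<le> 1" "1 - t = \<rho> / (n + \<rho>)"
      using \<open>n > 0\<close> \<open>\<rho> > 0\<close> by (auto simp: t_def field_simps)
    \<comment> \<open>The point opposite to \<open>y\<close> on the sphere of radius
      \<open>\<rho>\<close>; \<open>t\<close> is the weight that makes the combination of
      \<open>y\<close> and \<open>w\<close> vanish.\<close>
    define w where "w = - (\<rho> / n) *\<^sub>R y"
    have "norm w \<le> \<rho>"
      using \<open>n > 0\<close> \<open>\<rho> > 0\<close> by (simp add: w_def n_def)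
    have "(1 - t) *\<^sub>R y + t *\<^sub>R w = 0"
      using \<open>n > 0\<close> unfolding t(3) by (simp add: t_def w_def)
    then have "g 0 \<le> (1 - t) * g y + t * g w"
      using convex_onD[OF assms(2) t(1,2), of y w] by simp
    also have "\<dots> \<le> (1 - t) * g y + t * (g 0 + 1)"
      using \<rho>[OF \<open>norm w \<le> \<rho>\<close>] t(1) by (simp add: mult_left_mono)
    finally have "(1 - t) * g 0 \<le> (1 - t) * g y + t"
      by (simp add: algebra_simps)
    then have "(n + \<rho>) * (\<rho> / (n + \<rho>) * g 0) \<le> (n + \<rho>) * (\<rho> / (n + \<rho>) * g y + n / (n + \<rho>))"
      unfolding t(3) using \<open>n > 0\<close> \<open>\<rho> > 0\<close> by (intro mult_left_mono) (auto simp: t_def)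
    then have "\<rho> * g 0 \<le> \<rho> * g y + n"
      using \<open>n > 0\<close> \<open>\<rho> > 0\<close> by (simp add: distrib_left)
    then show ?thesis
      using \<open>\<rho> > 0\<close> by (simp add: n_def field_simps)
  qed auto
  then show thesis
    using \<open>\<rho> > 0\<close> that[of "1 / \<rho>" "g 0"] by simp
qed

lemma convex_bounded_below_on_bounded:
  fixes g :: "'a::real_inner \<Rightarrow> real"
  assumes "continuous_on UNIV g" "convex_on UNIV g" "bounded S"
  obtains m where "\<And>y. y \<in> S \<Longrightarrow> m \<le> g y"
proof -
  obtain K c where K: "0 < K" "\<And>y. c - K * norm y \<le> g y"
    using continuous_convex_lower_bound assms by blast
  obtain B where B: "\<And>y. y \<in> S \<Longrightarrow> norm y \<le> B"
    using \<open>bounded S\<close> by (auto simp: bounded_iff)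
  have "c - K * B \<le> g y" if "y \<in> S" for y
    using K(2)[of y] mult_left_mono[OF B[OF that], of K] \<open>0 < K\<close> by linarith
  then show thesis using that by blast
qed

text \<open>The linear minorant is dominated by the quadratic term, so a minimizer exists, and
  quadratic growth makes it unique. This justifies the description operator in
  \<open>Prox\<close>.\<close>

lemma Prox_inequality:
  fixes g :: "'a::{real_inner, complete_space} \<Rightarrow> real"
  assumes "continuous_on UNIV g" "convex_on UNIV g"
  shows "g (Prox g x) + 1/2 * (norm (x - Prox g x))\<^sup>2 + 1/2 * (norm (Prox g x - z))\<^sup>2
    \<le> g z + 1/2 * (norm (x - z))\<^sup>2"
proof -
  obtain K c where K: "0 < K" "\<And>y. c - K * norm y \<le> g y"
    using continuous_convex_lower_bound assms by blast
  \<comment> \<open>The constant comes from completing the square: -K s + s^2/2 is smallest at s =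
    K.\<close>
  have "c - K * norm x - K\<^sup>2 / 2 \<le> g y + 1/2 * (norm (x - y))\<^sup>2" for y
  proof -
    have "norm y \<le> norm x + norm (x - y)"
      by (metis norm_minus_commute norm_triangle_sub)
    then have "K * norm y \<le> K * (norm x + norm (x - y))"
      using \<open>0 < K\<close> by (intro mult_left_mono) auto
    moreover have "0 \<le> (K - norm (x - y))\<^sup>2" by simp
    ultimately show ?thesis
      using K(2)[of y] by (simp add: power2_eq_square algebra_simps)
  qed
  then obtain y where y: "\<And>z. g y + 1/2 * (norm (x - y))\<^sup>2 + 1/2 * (norm (y - z))\<^sup>2 \<le> g z + 1/2 * (norm (x - z))\<^sup>2"
    using ex_min_convex_plus_power2_norm[OF closed_UNIV _ assms(1,2), where m = "c - K * norm x - K\<^sup>2 / 2" and x = x]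
    by (metis UNIV_I UNIV_not_empty)
  have "Prox g x = y"
    unfolding Prox_def
  proof (rule the_equality)
    show "is_arg_min (\<lambda>y. g y + 1/2 * (norm (x - y))\<^sup>2) (\<lambda>_. True) y"
      using order_trans[OF _ y] by (simp add: is_arg_min_def not_less)
  next
    fix w assume "is_arg_min (\<lambda>y. g y + 1/2 * (norm (x - y))\<^sup>2) (\<lambda>_. True) w"
    then have "g w + 1/2 * (norm (x - w))\<^sup>2 \<le> g y + 1/2 * (norm (x - y))\<^sup>2"
      by (auto simp: is_arg_min_def not_less)
    with y[of w] have "(norm (y - w))\<^sup>2 \<le> 0" by linarith
    then show "w = y" by simp
  qed
  with y show ?thesis by simp
qed

text \<open>With \<open>g\<close> zero, expanding the squares in the growth inequality gives exactly
  the variational inequality.\<close>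

lemma projection_closed_convex:
  fixes C :: "'a::{real_inner, complete_space} set"
  assumes "closed C" "C \<noteq> {}" "convex C"
  obtains q where "q \<in> C" "\<And>z. z \<in> C \<Longrightarrow> (x - q) \<bullet> (z - q) \<le> 0"
proof -
  obtain q where q: "q \<in> C" "\<And>z. z \<in> C \<Longrightarrow> 1/2 * (norm (x - q))\<^sup>2 + 1/2 * (norm (q - z))\<^sup>2 \<le> 1/2 * (norm (x - z))\<^sup>2"
    using ex_min_convex_plus_power2_norm[of C "\<lambda>_. 0" 0 x] assms by (auto simp: convex_on_def)
  have "(x - q) \<bullet> (z - q) \<le> 0" if "z \<in> C" for z
    using q(2)[OF that] unfolding power2_norm_eq_inner
    by (simp add: inner_simps inner_commute field_simps)
  with q(1) that show thesis by blast
qed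

text \<open>The representing vector minimizes 1/2 |z|^2 - L z, that is, it is a proximal point of -L
  at 0. The proximal inequality bounds the linear map L - <p, .> from above, which forces it to be
  zero.\<close>

lemma riesz_representation:
  fixes L :: "'a::{real_inner, complete_space} \<Rightarrow> real"
  assumes "bounded_linear L"
  obtains p where "\<And>z. L z = p \<bullet> z"
proof -
  interpret bounded_linear L by fact
  have conv: "convex_on UNIV (\<lambda>z. - L z)"
    by (auto simp: convex_on_def add scaleR)
  have cont: "continuous_on UNIV (\<lambda>z. - L z)"
    by (intro continuous_intros linear_continuous_on assms)
  define p where "p = Prox (\<lambda>z. - L z) 0"
  have p: "L z - p \<bullet> z \<le> L p - p \<bullet> p" for z
    using Prox_inequality[OF cont conv, of 0 z] unfolding p_def[symmetric] power2_norm_eq_inner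
    by (simp add: inner_simps inner_commute field_simps)
  have le: "L z - p \<bullet> z \<le> 0" for z
  proof (rule ccontr)
    assume "\<not> ?thesis"
    then have pos: "L z - p \<bullet> z > 0" by simp
    then obtain k :: nat where "L p - p \<bullet> p < real k * (L z - p \<bullet> z)"
      using reals_Archimedean3 by blast
    then show False
      using p[of "real k *\<^sub>R z"] by (simp add: scaleR algebra_simps)
  qed
  have "L z = p \<bullet> z" for z
    using le[of z] le[of "- z"] scaleR[of "-1" z] by simp
  then show thesis by (rule that)
qed

subsection \<open>Weak convergence in Hilbert spaces\<close>

text \<open>Tychonoff instead of an explicit diagonal construction: the box is compact, and over a
  countable index set the product topology is metrizable, so compactness is sequential.\<close>

lemma bounded_imp_subseq_pointwise_convergent:
  fixes s :: "nat \<Rightarrow> nat \<Rightarrow> real"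
  assumes "\<And>k m. \<bar>s k m\<bar> \<le> B m"
  obtains r where "strict_mono r" "\<And>m. convergent (\<lambda>k. s (r k) m)"
proof -
  define K where "K = (PiE UNIV (\<lambda>m. {- B m..B m}))"
  have "compactin (product_topology (\<lambda>_. euclidean) UNIV) K"
    unfolding K_def by (subst compactin_PiE) auto
  then have "compact K"
    by (simp add: euclidean_product_topology)
  moreover have "\<forall>k. s k \<in> K"
    using assms by (auto simp: K_def abs_le_iff minus_le_iff)
  ultimately obtain l r where "strict_mono (r :: nat \<Rightarrow> nat)" and l: "(s \<circ> r) \<longlonglongrightarrow> l"
    unfolding compact_def by blast
  moreover have "(\<lambda>k. s (r k) m) \<longlonglongrightarrow> l m" for m
  proof -
    have "isCont (\<lambda>f :: nat \<Rightarrow> real. f m) l"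
      using continuous_on_product_coordinates[of m] continuous_on_eq_continuous_at[OF open_UNIV] by blast
    from isCont_tendsto_compose[OF this l] show ?thesis by (simp add: o_def)
  qed
  ultimately show thesis
    using that by (auto simp: convergent_def)
qed

text \<open>A diagonal subsequence converges against every \<open>s m\<close>. The set of all \<open>v\<close> against which it
  converges is a closed subspace \<open>V\<close>; since the orthogonal complement of \<open>V\<close> annihilates every
  \<open>s m\<close>, it is contained in \<open>V\<close>, so \<open>V\<close> is the whole space. No separability is needed.\<close>

lemma bounded_imp_weakly_convergent_subseq:
  fixes s :: "nat \<Rightarrow> 'a::{real_inner, complete_space}"
  assumes "bounded (range s)"
  obtains r p where "strict_mono r" "weakly_tendsto (s \<circ> r) p"
proof -
  obtain B where "B > 0" and B: "\<And>k. norm (s k) \<le> B"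
    using assms by (auto simp: bounded_pos)
  have "\<bar>s k \<bullet> s m\<bar> \<le> B * norm (s m)" for k m
    using Cauchy_Schwarz_ineq2[of "s k" "s m"] mult_right_mono[OF B[of k], of "norm (s m)"] by simp
  then obtain r where r: "strict_mono r" and conv: "\<And>m. convergent (\<lambda>k. s (r k) \<bullet> s m)"
    using bounded_imp_subseq_pointwise_convergent[of "\<lambda>k m. s k \<bullet> s m" "\<lambda>m. B * norm (s m)"] by blast
  define V where "V = {v. convergent (\<lambda>k. s (r k) \<bullet> v)}"
  have sub: "subspace V"
    unfolding subspace_def V_def
    by (auto simp: inner_add_right intro!: convergent_add convergent_mult convergent_const)
  have "closed V"
    unfolding closed_sequential_limits
  proof (intro allI impI, elim conjE)
    fix v l assume v: "\<forall>n. v n \<in> V" and l: "v \<longlonglongrightarrow> l"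
    have "Cauchy (\<lambda>k. s (r k) \<bullet> l)"
    proof (rule metric_CauchyI)
      fix e :: real assume "e > 0"
      then have "e / (3 * B) > 0" using \<open>B > 0\<close> by simp
      then obtain n where n: "norm (v n - l) < e / (3 * B)"
        using LIMSEQ_D[OF l] by blast
      have small: "\<bar>s k \<bullet> (v n - l)\<bar> < e / 3" for k
      proof -
        have "\<bar>s k \<bullet> (v n - l)\<bar> \<le> B * norm (v n - l)"
          using Cauchy_Schwarz_ineq2[of "s k" "v n - l"] mult_right_mono[OF B[of k], of "norm (v n - l)"] by simp
        also have "\<dots> < e / 3"
          using n \<open>B > 0\<close> by (simp add: field_simps)
        finally show ?thesis .
      qed
      have "Cauchy (\<lambda>k. s (r k) \<bullet> v n)"
        using v by (simp add: V_def Cauchy_convergent_iff)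
      then obtain M where M: "\<And>i j. M \<le> i \<Longrightarrow> M \<le> j \<Longrightarrow> dist (s (r i) \<bullet> v n) (s (r j) \<bullet> v n) < e / 3"
        using \<open>e > 0\<close> by (meson metric_CauchyD divide_pos_pos zero_less_numeral)
      have "dist (s (r i) \<bullet> l) (s (r j) \<bullet> l) < e" if "M \<le> i" "M \<le> j" for i j
        using M[OF that] small[of "r i"] small[of "r j"]
        unfolding dist_real_def inner_diff_right by argo
      then show "\<exists>M. \<forall>i\<ge>M. \<forall>j\<ge>M. dist (s (r i) \<bullet> l) (s (r j) \<bullet> l) < e"
        by blast
    qed
    then show "l \<in> V"
      by (simp add: V_def Cauchy_convergent_iff)
  qed
  have "u \<in> V" for u
  proof -
    obtain q where q: "q \<in> V" "\<And>z. z \<in> V \<Longrightarrow> (u - q) \<bullet> (z - q) \<le> 0"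
      using projection_closed_convex[OF \<open>closed V\<close> _ subspace_imp_convex[OF sub]] subspace_0[OF sub] by blast
    have orth: "(u - q) \<bullet> v = 0" if "v \<in> V" for v
      using q(2)[of "q + v"] q(2)[of "q - v"] subspace_add[OF sub q(1) that] subspace_diff[OF sub q(1) that]
      by simp
    have "s m \<in> V" for m
      using conv by (simp add: V_def)
    then have "s (r k) \<bullet> (u - q) = 0" for k
      using orth by (metis inner_commute)
    then have "u - q \<in> V"
      by (simp add: V_def convergent_const)
    then show "u \<in> V"
      using subspace_add[OF sub q(1)] by fastforce
  qed
  then have lim: "(\<lambda>k. s (r k) \<bullet> u) \<longlonglongrightarrow> lim (\<lambda>k. s (r k) \<bullet> u)" for u
    by (simp add: V_def convergent_LIMSEQ_iff)
  define L where "L u = lim (\<lambda>k. s (r k) \<bullet> u)" for u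
  note lim = lim[folded L_def]
  have "bounded_linear L"
  proof (rule bounded_linear_intro)
    show "L (u + v) = L u + L v" for u v
      using LIMSEQ_unique[OF lim[of "u + v"]] tendsto_add[OF lim[of u] lim[of v]]
      by (simp add: inner_add_right)
    show "L (c *\<^sub>R u) = c *\<^sub>R L u" for c u
      using LIMSEQ_unique[OF lim[of "c *\<^sub>R u"]] tendsto_mult_left[OF lim[of u], of c] by simp
    show "norm (L u) \<le> norm u * B" for u
    proof (rule LIMSEQ_le_const2[OF tendsto_norm[OF lim[of u]]], intro exI allI impI)
      fix k
      show "norm (s (r k) \<bullet> u) \<le> norm u * B"
        using Cauchy_Schwarz_ineq2[of "s (r k)" u] mult_right_mono[OF B[of "r k"], of "norm u"]
        by (simp add: mult.commute)
    qed
  qed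
  then obtain p where "\<And>z. L z = p \<bullet> z"
    using riesz_representation by blast
  with lim r show thesis
    by (intro that[of r p]) (auto simp: weakly_tendsto_def)
qed

lemma weakly_tendsto_add_null:
  assumes "weakly_tendsto s p" "(\<lambda>n. t n - s n) \<longlonglongrightarrow> 0"
  shows "weakly_tendsto t p"
  unfolding weakly_tendsto_def
proof
  fix u
  have "(\<lambda>n. s n \<bullet> u + (t n - s n) \<bullet> u) \<longlonglongrightarrow> p \<bullet> u + 0 \<bullet> u"
    using assms(1) by (intro tendsto_add tendsto_inner[OF assms(2) tendsto_const]) (simp add: weakly_tendsto_def)
  then show "(\<lambda>n. t n \<bullet> u) \<longlonglongrightarrow> p \<bullet> u"
    by (simp add: inner_diff_left)
qed

text \<open>The sublevel set at \<open>g p - e\<close> is closed, convex and misses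
  \<open>p\<close>. The projection of \<open>p\<close> onto it gives a separating half-space, and
  weak convergence eventually puts \<open>s n\<close> strictly on the side of
  \<open>p\<close>.\<close>

lemma convex_weakly_lsc:
  fixes g :: "'a::{real_inner, complete_space} \<Rightarrow> real"
  assumes "continuous_on UNIV g" "convex_on UNIV g" "weakly_tendsto s p" "e > 0"
  shows "eventually (\<lambda>n. g p - e < g (s n)) sequentially"
proof -
  define C where "C = {z. g z \<le> g p - e}"
  have "closed C"
    using assms(1) by (auto simp: C_def intro!: closed_Collect_le continuous_intros)
  have "convex C"
    unfolding C_def convex_def
  proof clarsimp
    fix y z and u v :: real
    assume *: "g y \<le> g p - e" "g z \<le> g p - e" "0 \<le> u" "0 \<le> v" "u + v = 1"
    have "g (u *\<^sub>R y + v *\<^sub>R z) \<le> u * g y + v * g z"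
      using assms(2) *(3-5) by (auto simp: convex_on_def)
    also have "\<dots> \<le> g p - e"
      using * by (rule convex_bound_le)
    finally show "g (u *\<^sub>R y + v *\<^sub>R z) \<le> g p - e" .
  qed
  show ?thesis
  proof (cases "C = {}")
    case True
    then show ?thesis by (auto simp: C_def not_le)
  next
    case False
    then obtain q where q: "q \<in> C" "\<And>z. z \<in> C \<Longrightarrow> (p - q) \<bullet> (z - q) \<le> 0"
      using projection_closed_convex[OF \<open>closed C\<close> _ \<open>convex C\<close>] by blast
    then have "p \<noteq> q"
      using \<open>e > 0\<close> by (auto simp: C_def)
    then have "0 < (p - q) \<bullet> (p - q)" by simp
    moreover have "(\<lambda>n. s n \<bullet> (p - q) - q \<bullet> (p - q)) \<longlonglongrightarrow> p \<bullet> (p - q) - q \<bullet> (p - q)"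
      using assms(3) by (intro tendsto_diff tendsto_const) (simp add: weakly_tendsto_def)
    ultimately have "eventually (\<lambda>n. 0 < s n \<bullet> (p - q) - q \<bullet> (p - q)) sequentially"
      by (intro order_tendstoD(1)) (auto simp: inner_diff_left)
    then show ?thesis
    proof eventually_elim
      case (elim n)
      then have "s n \<notin> C"
        using q(2)[of "s n"] by (auto simp: inner_diff_left[symmetric] inner_commute)
      then show ?case by (simp add: C_def)
    qed
  qed
qed

text \<open>Rewriting firm nonexpansiveness as monotonicity of \<open>Id - T\<close> paired with \<open>T\<close>
  turns the demiclosedness principle into a passage to the limit in one inner product.\<close>

lemma firmly_nonexpansive_demiclosed:
  fixes T :: "'a::{real_inner, complete_space} \<Rightarrow> 'a"
  assumes "firmly_nonexpansive T" "weakly_tendsto s p" "bounded (range s)"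
    and "(\<lambda>n. s n - T (s n)) \<longlonglongrightarrow> 0"
  shows "T p = p"
proof -
  define e where "e n = s n - T (s n)" for n
  define d where "d = p - T p"
  have mono: "0 \<le> (e n - d) \<bullet> (T (s n) - T p)" for n
  proof -
    have "(norm (T (s n) - T p))\<^sup>2 + (norm (e n - d))\<^sup>2 \<le> (norm ((e n - d) + (T (s n) - T p)))\<^sup>2"
      using assms(1) by (auto simp: firmly_nonexpansive_def e_def d_def)
    then show ?thesis
      unfolding power2_norm_eq_inner by (simp add: inner_add_left inner_add_right inner_commute)
  qed
  have e: "e \<longlonglongrightarrow> 0"
    using assms(4) by (simp add: e_def[abs_def])
  have "bounded (range (\<lambda>n. s n - e n - T p))"
  proof -
    have "bounded (range e)"
      using e by (rule convergent_imp_bounded)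
    then show ?thesis
      using assms(3) by (intro bounded_minus_comp) auto
  qed
  then obtain B where B: "\<And>n. norm (s n - e n - T p) \<le> B"
    by (auto simp: bounded_iff)
  have "(\<lambda>n. e n \<bullet> (s n - e n - T p)) \<longlonglongrightarrow> 0"
  proof (rule Lim_null_comparison)
    show "eventually (\<lambda>n. norm (e n \<bullet> (s n - e n - T p)) \<le> norm (e n) * B) sequentially"
      using order_trans[OF Cauchy_Schwarz_ineq2 mult_left_mono[OF B norm_ge_zero]]
      by (intro always_eventually allI) simp
    show "(\<lambda>n. norm (e n) * B) \<longlonglongrightarrow> 0"
      using tendsto_mult_left_zero[OF tendsto_norm_zero[OF e]] .
  qed
  moreover have "(\<lambda>n. d \<bullet> (s n - e n - T p)) \<longlonglongrightarrow> d \<bullet> (p - 0 - T p)"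
  proof -
    have "(\<lambda>n. s n \<bullet> d) \<longlonglongrightarrow> p \<bullet> d"
      using assms(2) by (simp add: weakly_tendsto_def)
    from tendsto_diff[OF tendsto_diff[OF this tendsto_inner[OF e tendsto_const]] tendsto_const]
    show ?thesis
      unfolding inner_diff_right inner_commute[of d] .
  qed
  \<comment> \<open>The monotonicity inequality passes to the limit as 0 <= -|d|^2.\<close>
  ultimately have "(\<lambda>n. e n \<bullet> (s n - e n - T p) - d \<bullet> (s n - e n - T p)) \<longlonglongrightarrow> 0 - d \<bullet> d"
    by (intro tendsto_diff) (auto simp: d_def)
  moreover have "0 \<le> e n \<bullet> (s n - e n - T p) - d \<bullet> (s n - e n - T p)" for n
    using mono[of n] by (simp add: e_def inner_diff_left)
  ultimately have "0 \<le> 0 - d \<bullet> d"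
    by (intro LIMSEQ_le_const) auto
  then have "d = 0"
    by (metis diff_0 inner_gt_zero_iff neg_0_le_iff_le not_le)
  then show ?thesis by (simp add: d_def)
qed

subsection \<open>The descent argument\<close>

text \<open>The proximal inequality at \<open>z\<close> and firm nonexpansiveness at the fixed point
  \<open>z\<close> add up, the terms in |y - z|^2 cancelling. Convexity of the squared norm handles
  the relaxation.\<close>

lemma firmly_nonexpansive_prox_step:
  fixes T :: "'a::{real_inner, complete_space} \<Rightarrow> 'a" and x :: 'a
  assumes "firmly_nonexpansive T" "T z = z" "continuous_on UNIV g" "convex_on UNIV g"
    and "0 < c" "0 \<le> a" "a \<le> 1"
  defines "y \<equiv> Prox (\<lambda>z. c * g z) x"
  shows "(norm (a *\<^sub>R x + (1 - a) *\<^sub>R T y - z))\<^sup>2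
    \<le> (norm (x - z))\<^sup>2 - (1 - a) * ((norm (x - y))\<^sup>2 + (norm (y - T y))\<^sup>2 + 2 * c * (g y - g z))"
proof -
  have "c * g y + 1/2 * (norm (x - y))\<^sup>2 + 1/2 * (norm (y - z))\<^sup>2 \<le> c * g z + 1/2 * (norm (x - z))\<^sup>2"
    unfolding y_def using assms(3-5)
    by (intro Prox_inequality continuous_intros convex_on_cmul) auto
  moreover have "(norm (T y - z))\<^sup>2 + (norm (y - T y))\<^sup>2 \<le> (norm (y - z))\<^sup>2"
    using assms(1) unfolding firmly_nonexpansive_def by (metis assms(2) diff_self diff_zero)
  ultimately have *: "(norm (T y - z))\<^sup>2 \<le> (norm (x - z))\<^sup>2
      - ((norm (x - y))\<^sup>2 + (norm (y - T y))\<^sup>2 + 2 * c * (g y - g z))"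
    by (simp add: algebra_simps)
  have "a *\<^sub>R x + (1 - a) *\<^sub>R T y - z = (1 - (1 - a)) *\<^sub>R (x - z) + (1 - a) *\<^sub>R (T y - z)"
    by (simp add: algebra_simps)
  then have "(norm (a *\<^sub>R x + (1 - a) *\<^sub>R T y - z))\<^sup>2
      \<le> a * (norm (x - z))\<^sup>2 + (1 - a) * (norm (T y - z))\<^sup>2"
    using power2_norm_convex_comb[of "1 - a" "x - z" "T y - z"] assms(6,7) by simp
  also have "\<dots> \<le> a * (norm (x - z))\<^sup>2 + (1 - a) * ((norm (x - z))\<^sup>2
      - ((norm (x - y))\<^sup>2 + (norm (y - T y))\<^sup>2 + 2 * c * (g y - g z)))"
    using * assms(7) by (intro add_left_mono mult_left_mono) auto
  finally show ?thesis
    by (simp add: algebra_simps)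
qed

text \<open>The descent argument for real sequences: \<open>a\<close> stands for the squared
  distance to a point of \<open>X\<close>, \<open>b\<close> for 1 - \<open>\<alpha>\<close>, and
  \<open>c\<close> for the value of the objective there.\<close>

lemma frequently_small_of_descent:
  fixes a b D S \<gamma> :: "nat \<Rightarrow> real"
  assumes descent: "\<And>n. a (Suc n) \<le> a n - b n * (D n + 2 * \<gamma> n * (S n - c))"
    and "\<And>n. 0 \<le> a n" "\<And>n. 0 \<le> D n" "\<And>n. m \<le> S n" "\<And>n. 0 < \<gamma> n" "\<gamma> \<longlonglongrightarrow> 0"
    and div: "filterlim (\<lambda>N. \<Sum>n\<le>N. \<gamma> n) at_top sequentially"
    and "0 < \<delta>" "eventually (\<lambda>n. \<delta> \<le> b n) sequentially" "0 < e"
  shows "frequently (\<lambda>n. D n < e \<and> S n < c + e) sequentially"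
proof (rule ccontr)
  assume "\<not> ?thesis"
  then have 1: "eventually (\<lambda>n. e \<le> D n \<or> c + e \<le> S n) sequentially"
    by (simp add: not_frequently de_Morgan_conj not_less)
  \<comment> \<open>This threshold lets \<open>e \<le> D n\<close> absorb the worst loss
    \<open>2 * \<gamma> n * \<bar>m - c\<bar>\<close> and still leave
    \<open>2 * \<gamma> n * e\<close>, the amount that the other alternative yields
    directly.\<close>
  have "(\<lambda>n. 2 * \<gamma> n * (e + \<bar>m - c\<bar>)) \<longlonglongrightarrow> 2 * 0 * (e + \<bar>m - c\<bar>)"
    by (intro tendsto_intros assms)
  then have 2: "eventually (\<lambda>n. 2 * \<gamma> n * (e + \<bar>m - c\<bar>) < e) sequentially"
    using \<open>0 < e\<close> by (intro order_tendstoD(2)) auto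
  have "eventually (\<lambda>n. a (Suc n) \<le> a n - 2 * \<delta> * e * \<gamma> n) sequentially"
    using 1 2 assms(9)
  proof eventually_elim
    case (elim n)
    have "2 * \<gamma> n * e \<le> D n + 2 * \<gamma> n * (S n - c)"
      using elim(1)
    proof
      assume "e \<le> D n"
      moreover have "2 * \<gamma> n * (- \<bar>m - c\<bar>) \<le> 2 * \<gamma> n * (S n - c)"
        using assms(4)[of n] assms(5)[of n] by (intro mult_left_mono) auto
      ultimately show ?thesis
        using elim(2) by (simp add: algebra_simps)
    next
      assume "c + e \<le> S n"
      then have "2 * \<gamma> n * e \<le> 2 * \<gamma> n * (S n - c)"
        using assms(5)[of n] by (intro mult_left_mono) auto
      then show ?thesis using assms(3)[of n] by linarith
    qed
    moreover have "0 \<le> 2 * \<gamma> n * e"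
      using assms(5)[of n] \<open>0 < e\<close> by simp
    ultimately have "\<delta> * (2 * \<gamma> n * e) \<le> b n * (D n + 2 * \<gamma> n * (S n - c))"
      using elim(3) \<open>0 < \<delta>\<close> by (intro mult_mono) auto
    then show ?case
      using descent[of n] by (simp add: mult_ac)
  qed
  then obtain N where N: "\<And>n. N \<le> n \<Longrightarrow> a (Suc n) \<le> a n - 2 * \<delta> * e * \<gamma> n"
    by (auto simp: eventually_sequentially)
  have bound: "2 * \<delta> * e * (\<Sum>n\<le>M. \<gamma> n) \<le> 2 * \<delta> * e * (\<Sum>n\<le>N. \<gamma> n) + a (Suc N) - a (Suc M)" if "N \<le> M" for M
    using that
  proof (induction M rule: dec_induct)
    case (step M)
    then show ?case using N[of "Suc M"] by (simp add: algebra_simps)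
  qed simp
  have pos: "0 < 2 * \<delta> * e" using \<open>0 < \<delta>\<close> \<open>0 < e\<close> by simp
  \<comment> \<open>A partial sum above \<open>K\<close> would make \<open>a (Suc M)\<close>
    negative in the telescoped bound.\<close>
  define K where "K = (\<Sum>n\<le>N. \<gamma> n) + a (Suc N) / (2 * \<delta> * e)"
  have K: "2 * \<delta> * e * K = 2 * \<delta> * e * (\<Sum>n\<le>N. \<gamma> n) + a (Suc N)"
    using \<open>0 < \<delta>\<close> \<open>0 < e\<close> by (simp add: K_def distrib_left)
  have "eventually (\<lambda>M. K < (\<Sum>n\<le>M. \<gamma> n)) sequentially"
    using div by (auto simp: filterlim_at_top_dense)
  then obtain M where M: "N \<le> M" "K < (\<Sum>n\<le>M. \<gamma> n)"
    using eventually_conj[OF eventually_ge_at_top[of N]] by (metis (mono_tags, lifting) eventually_sequentially le_refl)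
  then have "2 * \<delta> * e * K < 2 * \<delta> * e * (\<Sum>n\<le>M. \<gamma> n)"
    using pos by (intro mult_strict_left_mono)
  then show False
    using bound[OF M(1)] assms(2)[of "Suc M"] K by linarith
qed

theorem theorem4p1:
  fixes I :: nat
    and T :: "nat \<Rightarrow> 'a::{real_inner, complete_space} \<Rightarrow> 'a"
    and X :: "'a set"
    and f :: "nat \<Rightarrow> 'a \<Rightarrow> real"
    and F :: "'a \<Rightarrow> real"
    and \<alpha> \<gamma> :: "nat \<Rightarrow> real"
    and x0 :: 'a
    and x :: "nat \<Rightarrow> 'a"
    and xi yi :: "nat \<Rightarrow> nat \<Rightarrow> 'a"
  assumes "1 \<le> I"
    and "\<And>i. i \<in> {1..I} \<Longrightarrow> firmly_nonexpansive (T i)"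
    and "X = (\<Inter>i\<in>{1..I}. Fix (T i))"
    and "X \<noteq> {}"
    and "\<And>i. i \<in> {1..I} \<Longrightarrow> continuous_on UNIV (f i)"
    and "\<And>i. i \<in> {1..I} \<Longrightarrow> convex_on UNIV (f i)"
    and "F = (\<lambda>z. \<Sum>i\<in>{1..I}. f i z)"
    and "\<And>n. 0 < \<alpha> n \<and> \<alpha> n \<le> 1"
    and "\<And>n. 0 < \<gamma> n"
    and "0 < liminf (\<lambda>n. ereal (\<alpha> n))"
    and "liminf (\<lambda>n. ereal (\<alpha> n)) \<le> limsup (\<lambda>n. ereal (\<alpha> n))"
    and "limsup (\<lambda>n. ereal (\<alpha> n)) < 1"
    and "\<gamma> \<longlonglongrightarrow> 0"
    and "filterlim (\<lambda>N. \<Sum>n\<le>N. \<gamma> n) at_top sequentially"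
    and "x 0 = x0"
    and "\<And>n. xi n 0 = x n"
    and "\<And>n i. i \<in> {1..I} \<Longrightarrow> yi n i = Prox (\<lambda>z. \<gamma> n * f i z) (xi n (i - 1))"
    and "\<And>n i. i \<in> {1..I} \<Longrightarrow>
           xi n i = \<alpha> n *\<^sub>R xi n (i - 1) + (1 - \<alpha> n) *\<^sub>R T i (yi n i)"
    and "\<And>n. x (Suc n) = xi n I"
    and "\<And>i. i \<in> {1..I} \<Longrightarrow> bounded (range (\<lambda>n. yi n i))"
  shows "\<forall>i\<in>{1..I}. \<exists>p. weak_seq_cluster_point (\<lambda>n. xi n i) p \<and>
           p \<in> {z \<in> X. \<forall>w\<in>X. F z \<le> F w}"
proof -
  have T: "firmly_nonexpansive (T i)" and f_cont: "continuous_on UNIV (f i)"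
    and f_conv: "convex_on UNIV (f i)" and y_bdd: "bounded (range (\<lambda>n. yi n i))"
    and y_eq: "yi n i = Prox (\<lambda>z. \<gamma> n * f i z) (xi n (i - 1))"
    and x_eq: "xi n i = \<alpha> n *\<^sub>R xi n (i - 1) + (1 - \<alpha> n) *\<^sub>R T i (yi n i)"
    if "i \<in> {1..I}" for i n
    using assms(2,5,6,17,18,20) that by auto
  have T_fix: "T i z = z" if "i \<in> {1..I}" "z \<in> X" for i z
    using that assms(3) by (auto simp: Fix_def)
  have \<alpha>: "0 \<le> \<alpha> n" "\<alpha> n \<le> 1" for n
    using assms(8)[of n] by auto

  \<comment> \<open>Descent over one full cycle of inner steps\<close>
  define d where "d n i = (norm (xi n (i - 1) - yi n i))\<^sup>2 + (norm (yi n i - T i (yi n i)))\<^sup>2" for n i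
  define D where "D n = (\<Sum>i\<in>{1..I}. d n i)" for n
  define S where "S n = (\<Sum>i\<in>{1..I}. f i (yi n i))" for n
  have d_nonneg: "0 \<le> d n i" for n i
    by (simp add: d_def)
  have descent: "(norm (x (Suc n) - z))\<^sup>2 \<le> (norm (x n - z))\<^sup>2 - (1 - \<alpha> n) * (D n + 2 * \<gamma> n * (S n - F z))"
    if "z \<in> X" for n z
  proof -
    have "(norm (xi n k - z))\<^sup>2 \<le> (norm (xi n 0 - z))\<^sup>2
        - (1 - \<alpha> n) * (\<Sum>i\<in>{1..k}. d n i + 2 * \<gamma> n * (f i (yi n i) - f i z))" if "k \<le> I" for k
      using that
    proof (induction k)
      case (Suc k)
      then have k: "Suc k \<in> {1..I}" by simp
      have "(norm (xi n (Suc k) - z))\<^sup>2 \<le> (norm (xi n k - z))\<^sup>2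
          - (1 - \<alpha> n) * (d n (Suc k) + 2 * \<gamma> n * (f (Suc k) (yi n (Suc k)) - f (Suc k) z))"
        using firmly_nonexpansive_prox_step[OF T[OF k] T_fix[OF k \<open>z \<in> X\<close>] f_cont[OF k] f_conv[OF k] assms(9)[of n] \<alpha>(1)[of n] \<alpha>(2), of "xi n k"]
          y_eq[OF k, of n] x_eq[OF k, of n]
        by (simp add: d_def)
      with Suc show ?case by (simp add: algebra_simps)
    qed simp
    from this[of I] show ?thesis
      by (simp add: assms(7,16,19) D_def S_def sum.distrib sum_distrib_left[symmetric] sum_subtractf)
  qed

  \<comment> \<open>Subsequence with vanishing residuals and asymptotically optimal values\<close>
  have "\<exists>m. \<forall>n. m \<le> f i (yi n i)" if "i \<in> {1..I}" for i
    using convex_bounded_below_on_bounded[OF f_cont[OF that] f_conv[OF that] y_bdd[OF that]] by (metis rangeI)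
  then obtain m' where m': "\<And>i n. i \<in> {1..I} \<Longrightarrow> m' i \<le> f i (yi n i)"
    by metis
  define m where "m = (\<Sum>i\<in>{1..I}. m' i)"
  have m: "m \<le> S n" for n
    unfolding m_def S_def using m' by (intro sum_mono)
  obtain c where "limsup (\<lambda>n. ereal (\<alpha> n)) < ereal c" "ereal c < 1"
    using ereal_dense2[OF assms(12)] by blast
  then have "c < 1" and "eventually (\<lambda>n. ereal (\<alpha> n) < ereal c) sequentially"
    using Limsup_lessD by (simp, blast)
  then have \<delta>: "eventually (\<lambda>n. 1 - c \<le> 1 - \<alpha> n) sequentially"
    by (auto elim: eventually_mono)
  have freq: "frequently (\<lambda>n. D n < e \<and> S n < F z + e) sequentially" if "z \<in> X" "0 < e" for z e
  proof (rule frequently_small_of_descent)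
    show "(norm (x (Suc n) - z))\<^sup>2 \<le> (norm (x n - z))\<^sup>2 - (1 - \<alpha> n) * (D n + 2 * \<gamma> n * (S n - F z))" for n
      using descent[OF \<open>z \<in> X\<close>] .
    show "0 \<le> D n" for n
      unfolding D_def by (intro sum_nonneg d_nonneg)
    show "0 < 1 - c" using \<open>c < 1\<close> by simp
  qed (use m assms(9,13,14) \<delta> \<open>0 < e\<close> in auto)
  \<comment> \<open>Otherwise \<open>freq\<close> with tolerance \<open>m - F z\<close> produces an
    \<open>n\<close> with \<open>S n < m\<close>.\<close>
  have "m \<le> F z" if "z \<in> X" for z
  proof (rule ccontr)
    assume "\<not> m \<le> F z"
    then have "0 < m - F z" by simp
    from frequently_ex[OF freq[OF that this]] show False
      using m by (auto simp: not_le[symmetric])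
  qed
  then have F_bdd: "bdd_below (F ` X)"
    by (auto simp: bdd_below_def)
  define \<mu> where "\<mu> = Inf (F ` X)"
  \<comment> \<open>One \<open>1 / Suc k\<close> pays for a nearly optimal \<open>z\<close>, which
    removes the dependence on \<open>z\<close>; the other is the tolerance in
    \<open>freq\<close>.\<close>
  have freq_\<mu>: "frequently (\<lambda>n. D n < 1 / Suc k \<and> S n < \<mu> + 2 / Suc k) sequentially" for k
  proof -
    obtain z where z: "z \<in> X" "F z < \<mu> + 1 / Suc k"
      using cInf_lessD[of "F ` X" "\<mu> + 1 / Suc k"] assms(4) by (auto simp: \<mu>_def)
    have "frequently (\<lambda>n. D n < 1 / Suc k \<and> S n < F z + 1 / Suc k) sequentially"
      using freq[OF z(1)] by simp
    then show ?thesis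
    proof (rule frequently_elim1)
      fix n assume "D n < 1 / Suc k \<and> S n < F z + 1 / Suc k"
      moreover have "2 / real (Suc k) = 1 / Suc k + 1 / Suc k"
        by simp
      ultimately show "D n < 1 / Suc k \<and> S n < \<mu> + 2 / Suc k"
        using z(2) by linarith
    qed
  qed
  obtain r where r: "strict_mono r" "\<And>k. D (r k) < 1 / Suc k" "\<And>k. S (r k) < \<mu> + 2 / Suc k"
  proof -
    have "\<exists>r. \<forall>k. (D (r k) < 1 / Suc k \<and> S (r k) < \<mu> + 2 / Suc k) \<and> r k < r (Suc k)"
    proof (rule dependent_nat_choice)
      show "\<exists>n. D n < 1 / Suc 0 \<and> S n < \<mu> + 2 / Suc 0"
        using frequently_ex[OF freq_\<mu>[of 0]] .
      show "\<exists>n'. (D n' < 1 / Suc (Suc k) \<and> S n' < \<mu> + 2 / Suc (Suc k)) \<and> n < n'" for n k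
        using freq_\<mu>[of "Suc k"] unfolding frequently_sequentially by (metis Suc_le_lessD)
    qed
    then show thesis
      using that by (auto simp: strict_mono_Suc_iff)
  qed

  \<comment> \<open>Common weak limit of all inner sequences\<close>
  have "1 \<in> {1..I}" using assms(1) by simp
  then have "bounded (range (\<lambda>k. yi (r k) 1))"
    using y_bdd by (rule_tac bounded_subset[of "range (\<lambda>n. yi n 1)"]) auto
  then obtain q p where q: "strict_mono q" and weak: "weakly_tendsto ((\<lambda>k. yi (r k) 1) \<circ> q) p"
    using bounded_imp_weakly_convergent_subseq by blast
  define \<rho> where "\<rho> = r \<circ> q"
  have "strict_mono \<rho>"
    unfolding \<rho>_def using r(1) q by (rule strict_mono_o)
  have inv: "(\<lambda>k. b / Suc (q k)) \<longlonglongrightarrow> 0" for b :: real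
    using LIMSEQ_subseq_LIMSEQ[OF LIMSEQ_Suc[OF lim_const_over_n[of b]] q] by (simp add: o_def)
  \<comment> \<open>A single null sequence that dominates every residual norm, as \<open>D\<close>
    is a sum of their squares.\<close>
  have sqrt_D: "(\<lambda>k. sqrt (D (\<rho> k))) \<longlonglongrightarrow> 0"
  proof -
    have "(\<lambda>k. D (\<rho> k)) \<longlonglongrightarrow> 0"
      using r(2) d_nonneg
      by (intro tendsto_sandwich[OF _ _ tendsto_const inv[of 1]] always_eventually)
        (auto simp: \<rho>_def D_def intro: sum_nonneg less_imp_le)
    then show ?thesis
      using tendsto_real_sqrt by fastforce
  qed
  have le_sqrt_D: "norm (xi n (i - 1) - yi n i) \<le> sqrt (D n)" "norm (yi n i - T i (yi n i)) \<le> sqrt (D n)"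
    if "i \<in> {1..I}" for n i
  proof -
    have "d n i \<le> D n"
      unfolding D_def using that d_nonneg by (intro member_le_sum) auto
    then have "(norm (xi n (i - 1) - yi n i))\<^sup>2 \<le> D n" "(norm (yi n i - T i (yi n i)))\<^sup>2 \<le> D n"
      unfolding d_def using zero_le_power2[of "norm (xi n (i - 1) - yi n i)"]
        zero_le_power2[of "norm (yi n i - T i (yi n i))"] by linarith+
    then show "norm (xi n (i - 1) - yi n i) \<le> sqrt (D n)" "norm (yi n i - T i (yi n i)) \<le> sqrt (D n)"
      by (simp_all add: real_le_rsqrt)
  qed
  have xy_null: "(\<lambda>k. yi (\<rho> k) i - xi (\<rho> k) (i - 1)) \<longlonglongrightarrow> 0"
    and yT_null: "(\<lambda>k. yi (\<rho> k) i - T i (yi (\<rho> k) i)) \<longlonglongrightarrow> 0" if "i \<in> {1..I}" for i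
    using le_sqrt_D[OF that]
    by (auto intro!: Lim_null_comparison[OF _ sqrt_D] always_eventually simp: norm_minus_commute)
  have xx_null: "(\<lambda>k. xi (\<rho> k) i - xi (\<rho> k) (i - 1)) \<longlonglongrightarrow> 0" if "i \<in> {1..I}" for i
  proof (rule Lim_null_comparison)
    show "eventually (\<lambda>k. norm (xi (\<rho> k) i - xi (\<rho> k) (i - 1)) \<le> 2 * sqrt (D (\<rho> k))) sequentially"
    proof (intro always_eventually allI)
      fix k
      let ?n = "\<rho> k"
      have "xi ?n i - xi ?n (i - 1) = (1 - \<alpha> ?n) *\<^sub>R (T i (yi ?n i) - xi ?n (i - 1))"
        by (simp add: x_eq[OF that] algebra_simps)
      then have "norm (xi ?n i - xi ?n (i - 1)) \<le> 1 * norm (T i (yi ?n i) - xi ?n (i - 1))"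
        using \<alpha>[of ?n] by (simp add: mult_left_le_one_le)
      also have "\<dots> = norm ((xi ?n (i - 1) - yi ?n i) + (yi ?n i - T i (yi ?n i)))"
        by (simp add: norm_minus_commute)
      also have "\<dots> \<le> 2 * sqrt (D ?n)"
        using le_sqrt_D[OF that, of ?n] by (intro norm_triangle_le) simp
      finally show "norm (xi ?n i - xi ?n (i - 1)) \<le> 2 * sqrt (D ?n)" .
    qed
    show "(\<lambda>k. 2 * sqrt (D (\<rho> k))) \<longlonglongrightarrow> 0"
      using tendsto_mult_right_zero[OF sqrt_D] .
  qed
  \<comment> \<open>The weak limit of \<open>yi _ 1\<close> passes to \<open>xi _ 0\<close> and from
    there along the inner index, consecutive differences being null in norm.\<close>
  have x_weak: "weakly_tendsto (\<lambda>k. xi (\<rho> k) i) p" if "i \<le> I" for i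
    using that
  proof (induction i)
    case 0
    have "(\<lambda>k. xi (\<rho> k) 0 - yi (\<rho> k) 1) \<longlonglongrightarrow> 0"
      using tendsto_minus[OF xy_null[OF \<open>1 \<in> {1..I}\<close>]] by simp
    then show ?case
      using weakly_tendsto_add_null weak by (fastforce simp: \<rho>_def o_def)
  next
    case (Suc i)
    then show ?case
      using weakly_tendsto_add_null[OF Suc.IH] xx_null[of "Suc i"] by simp
  qed
  have y_weak: "weakly_tendsto (\<lambda>k. yi (\<rho> k) i) p" if "i \<in> {1..I}" for i
    using that by (intro weakly_tendsto_add_null[OF x_weak xy_null]) auto

  \<comment> \<open>Feasibility and optimality of the weak limit\<close>
  have "T i p = p" if "i \<in> {1..I}" for i
  proof (rule firmly_nonexpansive_demiclosed[OF T[OF that] y_weak[OF that] _ yT_null[OF that]])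
    show "bounded (range (\<lambda>k. yi (\<rho> k) i))"
      using y_bdd[OF that] by (rule bounded_subset) auto
  qed
  then have "p \<in> X"
    using assms(3) by (auto simp: Fix_def)
  have "F p \<le> \<mu>"
  proof (rule field_le_epsilon)
    fix e :: real assume "0 < e"
    \<comment> \<open>The \<open>I\<close> lower semicontinuity errors add up to e/2; the other half
      absorbs \<open>2 / Suc (q k)\<close>, the excess of \<open>S\<close> over
      \<open>\<mu>\<close>.\<close>
    define e' where "e' = e / (2 * real I)"
    have "0 < e'" using \<open>0 < e\<close> assms(1) by (simp add: e'_def)
    have "eventually (\<lambda>k. \<forall>i\<in>{1..I}. f i p - e' < f i (yi (\<rho> k) i)) sequentially"
      using convex_weakly_lsc[OF f_cont f_conv y_weak \<open>0 < e'\<close>] by (intro eventually_ball_finite) auto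
    moreover have "eventually (\<lambda>k. 2 / Suc (q k) < e / 2) sequentially"
      using \<open>0 < e\<close> by (intro order_tendstoD(2)[OF inv]) auto
    ultimately obtain k where k: "\<forall>i\<in>{1..I}. f i p - e' < f i (yi (\<rho> k) i)" "2 / Suc (q k) < e / 2"
      using eventually_happens'[OF sequentially_bot eventually_conj] by blast
    have "F p - e / 2 = (\<Sum>i\<in>{1..I}. f i p - e')"
      using assms(1) by (simp add: assms(7) sum_subtractf e'_def)
    also have "\<dots> \<le> S (\<rho> k)"
      unfolding S_def using k(1) by (intro sum_mono less_imp_le) blast
    also have "\<dots> < \<mu> + e / 2"
      using r(3)[of "q k"] k(2) by (simp add: \<rho>_def)
    finally show "F p \<le> \<mu> + e" by simp
  qed
  then have "F p \<le> F w" if "w \<in> X" for w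
    using cInf_lower[OF imageI[OF that] F_bdd] by (simp add: \<mu>_def)
  \<comment> \<open>The same \<open>p\<close> and the same subsequence \<open>\<rho>\<close> serve
    every \<open>i\<close>.\<close>
  with \<open>p \<in> X\<close> show ?thesis
    using x_weak \<open>strict_mono \<rho>\<close> by (auto simp: weak_seq_cluster_point_def o_def intro!: exI[of _ p] exI[of _ \<rho>])
qed

end
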